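(* Let $n\ge 1$, $k\ge 1$, let $\mathbf{a}_d(\cdot,k-1):\mathbb{R}^n\to\mathbb{R}^n$ be a polynomial map (of degree at most $d$), and consider the system equation $\mathbf{x}(k)=\mathbf{a}_d(\mathbf{x}(k-1),k-1)+\mathbf{w}(k-1)$, where the only information on the process noise is $\mathbf{w}(k-1)\in\mathcal{W}_{k-1}$, with $\mathcal{W}_{k-1}\subset\mathbb{R}^n$ a compact basic semialgebraic set. Assume that the only probabilistic knowledge about $\mathbf{X}(k-1)$ is its support $\mathcal{X}_{k-1}\subset\mathbb{R}^n$ (a Borel set), i.e. the probability measure of $\mathbf{X}(k-1)$ may be any element of $\mathcal{P}_{\mathcal{X}_{k-1}}(\mathbf{X}(k-1))$. Then the probability measure of the state $\mathbf{x}(k)$ at time $k$ belongs to a set $\hat{\mathcal{P}}_{\hat{\mathcal{X}}_k}(\mathbf{X}(k))$ (the predicted set, obtained by applying the Chapman-Kolmogorov equation element-wise as described in the context) satisfying $$\hat{\mathcal{P}}_{\hat{\mathcal{X}}_k}(\mathbf{X}(k))\equiv \mathrm{Co}\{\delta_{\hat{\mathbf{x}}}:\ \hat{\mathbf{x}}\in\hat{\mathcal{X}}_k\},$$ where $$\hat{\mathcal{X}}_k=\{\mathbf{a}_d(\mathbf{x},k-1)+\mathbf{w}:\ \mathbf{x}\in\mathcal{X}_{k-1},\ \mathbf{w}\in\mathcal{W}_{k-1}\},$$ or equivalently $$\hat{\mathcal{X}}_k=\{\mathbf{z}\in\mathbb{R}^n:\ \mathbf{z}-\mathbf{a}_d(\mathbf{x},k-1)\in\mathcal{W}_{k-1}\text{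 for some }\mathbf{x}\in\mathcal{X}_{k-1}\}.$$
   Context: A basic semialgebraic set is a set defined by finitely many polynomial inequalities. For a Borel set $\mathcal{X}\subseteq\mathbb{R}^n$, $\mathcal{P}_{\mathcal{X}}(\mathbf{X})$ denotes the set of all Borel probability measures $P$ on $\mathbb{R}^n$ with $\int_{\mathcal{X}}dP=1$ ("measures with support $\mathcal{X}$"). $\delta_{\mathbf{x}}$ is the Dirac (atomic) measure at $\mathbf{x}$, and $\mathrm{Co}$ denotes convex hull. For two sets $\mathcal{A},\mathcal{B}$ of Borel probability measures on $\mathbb{R}^n$, $\mathcal{A}\equiv\mathcal{B}$ means that they are equivalent in terms of inferences (expectations): for every bounded Borel function $g:\mathbb{R}^n\to\mathbb{R}$, $\sup_{P\in\mathcal{A}}\int g\,dP=\sup_{P\in\mathcal{B}}\int g\,dP$ (and hence the same for infima, replacing $g$ by $-g$). Predicted set: the information $\mathbf{w}(k-1)\in\mathcal{W}_{k-1}$ means that, given $\mathbf{x}(k-1)=\mathbf{x}$, the conditional probability measure of $\mathbf{X}(k)$ may be any Borel probability measure concentrated on $\{\mathbf{a}_d(\mathbf{x},k-1)+\mathbf{w}:\mathbf{w}\in\mathcal{W}_{k-1}\}$. The predicted set $\hat{\mathcal{P}}_{\hat{\mathcal{X}}_k}(\mathbf{X}(k))$ is the set of all measures $A\mapsto\int_{\mathbb{R}^n} K(\mathbf{x},A)\,dQ(\mathbf{x})$ (Chapman-Kolmogorov equation), where $Q\in\mathcal{P}_{\mathcal{X}_{k-1}}(\mathbf{X}(k-1))$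 and $K$ is a Markov kernel from $\mathbb{R}^n$ to $\mathbb{R}^n$ with $K(\mathbf{x},\mathbf{a}_d(\mathbf{x},k-1)+\mathcal{W}_{k-1})=1$ for every $\mathbf{x}\in\mathcal{X}_{k-1}$. *)

theory Defs
  imports "HOL-Probability.Probability"
begin

text \<open>
  Exponent vectors are functions \<open>'n \<Rightarrow> nat\<close>; the index set below is finite
  (lemma \<open>finite_exponents\<close>), so the sum is a genuine one.
\<close>

definition exponents_upto :: "nat \<Rightarrow> ('n::finite \<Rightarrow> nat) set" where
  "exponents_upto d = {\<alpha>. (\<Sum>i\<in>UNIV. \<alpha> i) \<le> d}"

definition polynomial_of_degree_le :: "nat \<Rightarrow> (real^'n \<Rightarrow> real) \<Rightarrow> bool" where
  "polynomial_of_degree_le d p \<longleftrightarrow>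
     (\<exists>c :: ('n \<Rightarrow> nat) \<Rightarrow> real.
        \<forall>x. p x = (\<Sum>\<alpha>\<in>exponents_upto d. c \<alpha> * (\<Prod>i\<in>UNIV. (x $ i) ^ \<alpha> i)))"

definition polynomial_map_of_degree_le :: "nat \<Rightarrow> (real^'n \<Rightarrow> real^'m) \<Rightarrow> bool" where
  "polynomial_map_of_degree_le d f \<longleftrightarrow> (\<forall>j. polynomial_of_degree_le d (\<lambda>x. f x $ j))"

lemma finite_exponents: "finite (exponents_upto d :: ('n::finite \<Rightarrow> nat) set)"
proof (rule finite_subset)
  show "exponents_upto d \<subseteq> (UNIV :: 'n set) \<rightarrow>\<^sub>E {..d}"
  proof
    fix \<alpha> :: "'n \<Rightarrow> nat"
    assume "\<alpha> \<in> exponents_upto d"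
    then have s: "sum \<alpha> UNIV \<le> d" by (simp add: exponents_upto_def)
    have "\<alpha> i \<le> d" for i
      using member_le_sum[of i UNIV \<alpha>] s by auto
    then show "\<alpha> \<in> UNIV \<rightarrow>\<^sub>E {..d}" by auto
  qed
  show "finite ((UNIV :: 'n set) \<rightarrow>\<^sub>E {..d})" by (intro finite_PiE) auto
qed

lemma real_polynomial_function_prod:
  "finite I \<Longrightarrow> (\<And>i. i \<in> I \<Longrightarrow> real_polynomial_function (f i)) \<Longrightarrow>
     real_polynomial_function (\<lambda>x. \<Prod>i\<in>I. f i x)"
  by (induction I rule: finite_induct) auto

lemma polynomial_of_degree_le_imp_real_polynomial_function:
  fixes p :: "real^'n \<Rightarrow> real"
  assumes "polynomial_of_degree_le d p"
  shows "real_polynomial_function p"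
proof -
  obtain c :: "('n \<Rightarrow> nat) \<Rightarrow> real" where
    p: "p = (\<lambda>x. \<Sum>\<alpha>\<in>exponents_upto d. c \<alpha> * (\<Prod>i\<in>UNIV. (x $ i) ^ \<alpha> i))"
    using assms by (auto simp: polynomial_of_degree_le_def)
  show ?thesis unfolding p
    by (intro real_polynomial_function_sum finite_exponents real_polynomial_function.intros(4)
        real_polynomial_function_prod real_polynomial_function_power
        real_polynomial_function.intros(1,2) bounded_linear_vec_nth) auto
qed

text \<open>
  Both weak and strict inequalities are admitted (hence also equations, as two weak ones).
\<close>

definition basic_semialgebraic :: "(real^'n) set \<Rightarrow> bool" where
  "basic_semialgebraic S \<longleftrightarrow>
     (\<exists>F G. finite F \<and> finite G \<and>
        (\<forall>p\<in>F \<union> G. real_polynomial_function p) \<and>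
        S = {x. (\<forall>p\<in>F. 0 \<le> p x) \<and> (\<forall>p\<in>G. 0 < p x)})"

text \<open>Borel probability measures giving full mass to the Borel set \<open>S\<close>.\<close>

definition measures_supported_on :: "('a::topological_space) set \<Rightarrow> 'a measure set" where
  "measures_supported_on S =
     {P. prob_space P \<and> sets P = sets borel \<and> emeasure P S = 1}"

text \<open>
  Suprema are taken in the extended reals, so that the supremum over the empty set is
  \<open>- \<infinity>\<close> rather than an unspecified real number.
\<close>

definition inference_equiv ::
  "('a::topological_space) measure set \<Rightarrow> 'a measure set \<Rightarrow> bool" where
  "inference_equiv \<A> \<B> \<longleftrightarrow>
     (\<forall>g :: 'a \<Rightarrow> real. g \<in> borel_measurable borel \<longrightarrow> bounded (range g) \<longrightarrow>
        (SUP P\<in>\<A>. ereal (\<integral>x. g x \<partial>P)) = (SUP P\<in>\<B>. ereal (\<integral>x. g x \<partial>P)))"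

text \<open>
  Measures do not form a real vector space, so \<open>convex hull\<close> does not apply;
  finite convex combinations are formed setwise.
\<close>

definition measure_convex_hull ::
  "('a::topological_space) measure set \<Rightarrow> 'a measure set" where
  "measure_convex_hull \<M> =
     {P. sets P = sets borel \<and>
         (\<exists>F c. finite F \<and> F \<subseteq> \<M> \<and> (\<forall>M\<in>F. 0 \<le> c M) \<and> sum c F = (1::real) \<and>
            (\<forall>A\<in>sets borel. emeasure P A = (\<Sum>M\<in>F. ennreal (c M) * emeasure M A)))}"

text \<open>
  A Markov kernel is a measurable map into \<^term>\<open>prob_algebra borel\<close>; it describes the
  possible laws of \<open>a x + w\<close> given \<open>x\<close>, when all that is known about \<open>w\<close> is \<open>w \<in> W\<close>.
  Nothing is required of the kernel outside \<open>X\<close>.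
\<close>

definition transition_kernels ::
  "('a::real_normed_vector \<Rightarrow> 'a) \<Rightarrow> 'a set \<Rightarrow> 'a set \<Rightarrow> ('a \<Rightarrow> 'a measure) set" where
  "transition_kernels a W X =
     {K \<in> borel \<rightarrow>\<^sub>M prob_algebra borel.
        \<forall>x\<in>X. K x \<in> measures_supported_on {a x + w | w. w \<in> W}}"

text \<open>
  The Chapman-Kolmogorov equation is the monadic bind of the Giry monad, see
  \<open>emeasure_Chapman_Kolmogorov\<close> below.
\<close>

definition predicted_measures ::
  "('a::real_normed_vector \<Rightarrow> 'a) \<Rightarrow> 'a set \<Rightarrow> 'a set \<Rightarrow> 'a measure set" where
  "predicted_measures a W X =
     {Q \<bind> K | Q K. Q \<in> measures_supported_on X \<and> K \<in> transition_kernels a W X}"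

lemma emeasure_Chapman_Kolmogorov:
  assumes Q: "Q \<in> measures_supported_on X" and K: "K \<in> transition_kernels a W X"
    and A: "A \<in> sets borel"
  shows "emeasure (Q \<bind> K) A = (\<integral>\<^sup>+x. emeasure (K x) A \<partial>Q)"
proof (rule emeasure_bind[where N = borel])
  have sQ: "sets Q = sets borel" using Q by (simp add: measures_supported_on_def)
  show "space Q \<noteq> {}" using sets_eq_imp_space_eq[OF sQ] by simp
  have "K \<in> borel \<rightarrow>\<^sub>M subprob_algebra borel"
    using K by (auto simp: transition_kernels_def intro: measurable_prob_algebraD)
  then show "K \<in> Q \<rightarrow>\<^sub>M subprob_algebra borel"
    using measurable_cong_sets[OF sQ refl] by blast
qed (rule A)

definition predicted_support :: "('a::plus \<Rightarrow> 'a) \<Rightarrow> 'a set \<Rightarrow> 'a set \<Rightarrow> 'a set" where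
  "predicted_support a W X = {a x + w | x w. x \<in> X \<and> w \<in> W}"

text \<open>
  \<open>K\<close> is a (regular) conditional distribution of \<open>z\<close> given \<open>x\<close>.
\<close>

definition conditional_law ::
  "'m measure \<Rightarrow> ('m \<Rightarrow> 'a::topological_space) \<Rightarrow> ('m \<Rightarrow> 'a) \<Rightarrow> ('a \<Rightarrow> 'a measure) \<Rightarrow> bool" where
  "conditional_law M x z K \<longleftrightarrow>
     K \<in> borel \<rightarrow>\<^sub>M prob_algebra borel \<and>
     (\<forall>A\<in>sets borel. \<forall>B\<in>sets borel.
        emeasure M {\<omega> \<in> space M. x \<omega> \<in> A \<and> z \<omega> \<in> B} =
        (\<integral>\<^sup>+y\<in>A. emeasure (K y) B \<partial>distr M borel x))"

end

theory Submission imports Defs begin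

text \<open>
  The predicted set and the convex hull of the Dirac measures both contain every Dirac measure at
  a point of the predicted support, and their elements give full mass to every Borel superset of
  it. For a bounded Borel function \<open>g\<close> with supremum \<open>s\<close> over the predicted support, these two
  properties already force the upper expectation to be \<open>s\<close>: the set \<open>{g \<le> s}\<close> is a Borel
  superset. The predicted support itself is in general only a continuous image of a Borel set and
  may fail to be Borel, which is why its mass is never considered. That the Dirac measures are
  predicted is seen from the deterministic kernels \<open>y \<mapsto> \<delta>(a y + w)\<close>, measurable as \<open>a\<close> is
  continuous.
\<close>

lemma SUP_expectation_eq_SUP:
  fixes g :: "'a::topological_space \<Rightarrow> real"
  assumes dirac: "\<And>z. z \<in> S \<Longrightarrow> return borel z \<in> \<A>"
    and sets: "\<And>P. P \<in> \<A> \<Longrightarrow> sets P = sets borel"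
    and mass: "\<And>P B. P \<in> \<A> \<Longrightarrow> B \<in> sets borel \<Longrightarrow> S \<subseteq> B \<Longrightarrow> emeasure P B = 1"
    and g: "g \<in> borel_measurable borel" and bdd: "bounded (range g)"
  shows "(SUP P\<in>\<A>. ereal (\<integral>x. g x \<partial>P)) = (SUP z\<in>S. ereal (g z))"
proof (rule antisym)
  define s where "s = (SUP z\<in>S. ereal (g z))"
  have "ereal (\<integral>x. g x \<partial>P) \<le> s" if P: "P \<in> \<A>" for P
  proof -
    have sP: "sets P = sets borel" using sets[OF P] .
    have spP: "space P = UNIV" using sets_eq_imp_space_eq[OF sP] by simp
    \<comment> \<open>\<open>UNIV\<close> is itself a Borel superset of \<open>S\<close>, so the
      mass hypothesis already makes \<open>P\<close> a probability measure.\<close>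
    have "emeasure P (space P) = 1" unfolding spP by (rule mass[OF P]) auto
    then interpret prob_space P by (rule prob_spaceI)
    have gP: "g \<in> borel_measurable P" using g measurable_cong_sets[OF sP refl] by blast
    obtain C where C: "\<And>x. \<bar>g x\<bar> \<le> C" using bdd by (auto simp: bounded_iff)
    have int: "integrable P g"
      using C gP by (intro integrable_const_bound[where B=C]) auto
    have B: "{x. ereal (g x) \<le> s} \<in> sets borel" using g by measurable
    have "emeasure P {x. ereal (g x) \<le> s} = 1"
      by (rule mass[OF P B]) (auto simp: s_def intro: SUP_upper)
    then have "prob {x. ereal (g x) \<le> s} = 1" by (simp add: emeasure_eq_measure)
    then have AE: "AE x in P. ereal (g x) \<le> s" using prob_eq_1[of "{x. ereal (g x) \<le> s}"] B sP by simp
    \<comment> \<open>The extended real \<open>s\<close> may be infinite. The value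
      \<open>-\<infinity>\<close> would bound the real-valued \<open>g\<close> almost surely by
      \<open>-\<infinity>\<close>, which is impossible under a probability measure; this covers
      empty \<open>S\<close>, where no such \<open>P\<close> exists.\<close>
    show ?thesis
    proof (cases s)
      case (real r)
      have "(\<integral>x. g x \<partial>P) \<le> r"
        by (rule integral_le_const[OF int]) (use AE real in simp)
      with real show ?thesis by simp
    next
      case MInf
      then show ?thesis using AE by simp
    qed simp
  qed
  then show "(SUP P\<in>\<A>. ereal (\<integral>x. g x \<partial>P)) \<le> (SUP z\<in>S. ereal (g z))"
    unfolding s_def by (rule SUP_least)
  show "(SUP z\<in>S. ereal (g z)) \<le> (SUP P\<in>\<A>. ereal (\<integral>x. g x \<partial>P))"
  proof (rule SUP_least)
    fix z assume "z \<in> S"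
    have "(\<integral>x. g x \<partial>return borel z) = g z" by (rule integral_return) (use g in auto)
    then show "ereal (g z) \<le> (SUP P\<in>\<A>. ereal (\<integral>x. g x \<partial>P))"
      using SUP_upper[OF dirac[OF \<open>z \<in> S\<close>], of "\<lambda>P. ereal (\<integral>x. g x \<partial>P)"] by simp
  qed
qed

lemma sets_measure_convex_hull: "P \<in> measure_convex_hull \<M> \<Longrightarrow> sets P = sets borel"
  by (simp add: measure_convex_hull_def)

lemma return_in_measure_convex_hull:
  assumes "z \<in> S"
  shows "return borel z \<in> measure_convex_hull {return borel y | y. y \<in> S}"
  unfolding measure_convex_hull_def
  by (rule CollectI, intro conjI exI[of _ "{return borel z}"] exI[of _ "\<lambda>_. 1"]) (use assms in auto)

text \<open>Each Dirac measure in the combination sits at a point of \<open>S\<close>, hence of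
  \<open>B\<close>, so the mass of \<open>B\<close> is the sum of the weights.\<close>

lemma emeasure_measure_convex_hull:
  assumes P: "P \<in> measure_convex_hull {return borel z | z. z \<in> S}"
    and B: "B \<in> sets borel" "S \<subseteq> B"
  shows "emeasure P B = 1"
proof -
  obtain F c where F: "F \<subseteq> {return borel z | z. z \<in> S}"
    and c: "\<forall>M\<in>F. 0 \<le> c M" "sum c F = (1::real)"
    and eq: "emeasure P B = (\<Sum>M\<in>F. ennreal (c M) * emeasure M B)"
    using P B(1) by (auto simp: measure_convex_hull_def)
  have "emeasure M B = 1" if M: "M \<in> F" for M
  proof -
    obtain z where "M = return borel z" "z \<in> S" using F M by blast
    with B show ?thesis by (auto simp: indicator_def)
  qed
  then have "emeasure P B = (\<Sum>M\<in>F. ennreal (c M))" by (simp add: eq)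
  also have "\<dots> = ennreal (sum c F)" using c(1) by (intro sum_ennreal) auto
  finally show ?thesis by (simp add: c(2))
qed

lemma space_measures_supported_on:
  "Q \<in> measures_supported_on X \<Longrightarrow> space Q = UNIV"
  using sets_eq_imp_space_eq[of Q borel] by (simp add: measures_supported_on_def)

text \<open>The bind takes its sigma-algebra from the values of the kernel. Over an empty space it
  degenerates by definition, hence the check that \<open>space Q\<close> is nonempty.\<close>

lemma sets_Chapman_Kolmogorov:
  assumes Q: "Q \<in> measures_supported_on X" and K: "K \<in> transition_kernels a W X"
  shows "sets (Q \<bind> K) = sets borel"
proof (rule sets_bind)
  show "sets (K x) = sets borel" if "x \<in> space Q" for x
    using measurable_space[of K borel "prob_algebra borel" x] K
    by (auto simp: transition_kernels_def space_prob_algebra)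
  show "space Q \<noteq> {}" using space_measures_supported_on[OF Q] by simp
qed

lemma sets_predicted_measures: "P \<in> predicted_measures a W X \<Longrightarrow> sets P = sets borel"
  by (auto simp: predicted_measures_def sets_Chapman_Kolmogorov)

lemma emeasure_eq_1_superset:
  assumes "P \<in> measures_supported_on S" "S \<subseteq> B" "B \<in> sets borel"
  shows "emeasure P B = 1"
proof (rule antisym)
  interpret prob_space P using assms by (simp add: measures_supported_on_def)
  show "emeasure P B \<le> 1" by (rule emeasure_le_1)
  \<comment> \<open>Monotonicity rests on the measurability of the larger set
    \<open>B\<close>.\<close>
  have "emeasure P S \<le> emeasure P B"
    by (rule emeasure_mono) (use assms in \<open>auto simp: measures_supported_on_def\<close>)
  then show "1 \<le> emeasure P B" using assms(1) by (simp add: measures_supported_on_def)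
qed

text \<open>A kernel is constrained only at points of \<open>X\<close>, but these have full measure
  under \<open>Q\<close>. There \<open>K x\<close> is concentrated on the translate of
  \<open>W\<close> by \<open>a x\<close>, which lies in \<open>B\<close>, so the Chapman-Kolmogorov
  integrand is 1 almost everywhere.\<close>

lemma emeasure_predicted_measures:
  assumes P: "P \<in> predicted_measures a W X" and X: "X \<in> sets borel"
    and B: "B \<in> sets borel" "predicted_support a W X \<subseteq> B"
  shows "emeasure P B = 1"
proof -
  obtain Q K where Q: "Q \<in> measures_supported_on X" and K: "K \<in> transition_kernels a W X"
    and P: "P = Q \<bind> K"
    using P by (auto simp: predicted_measures_def)
  interpret Q: prob_space Q using Q by (simp add: measures_supported_on_def)
  have "Q.prob X = 1" using Q by (simp add: measures_supported_on_def Q.emeasure_eq_measure)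
  \<comment> \<open>Since \<open>X\<close> is Borel, full mass can be read as an almost sure
    statement.\<close>
  then have "AE x in Q. x \<in> X"
    using Q.prob_eq_1[of X] X Q by (simp add: measures_supported_on_def)
  moreover have "emeasure (K x) B = 1" if "x \<in> X" for x
  proof (rule emeasure_eq_1_superset)
    show "K x \<in> measures_supported_on {a x + w | w. w \<in> W}"
      using K that by (simp add: transition_kernels_def)
    show "{a x + w | w. w \<in> W} \<subseteq> B" using that B(2) by (auto simp: predicted_support_def)
  qed (rule B(1))
  ultimately have "AE x in Q. emeasure (K x) B = 1" by auto
  then have "(\<integral>\<^sup>+x. emeasure (K x) B \<partial>Q) = (\<integral>\<^sup>+x. 1 \<partial>Q)" by (rule nn_integral_cong_AE)
  then show ?thesis
    using emeasure_Chapman_Kolmogorov[OF Q K B(1)] by (simp add: P Q.emeasure_space_1)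
qed

lemma return_in_measures_supported_on:
  "S \<in> sets borel \<Longrightarrow> x \<in> S \<Longrightarrow> return borel x \<in> measures_supported_on S"
  by (simp add: measures_supported_on_def prob_space_return)

lemma return_in_predicted_measures:
  fixes a :: "'a::real_normed_vector \<Rightarrow> 'a"
  assumes a: "\<And>w. (\<lambda>x. a x + w) \<in> borel_measurable borel"
    and shift: "\<And>x. {a x + w | w. w \<in> W} \<in> sets borel"
    and X: "X \<in> sets borel" and z: "z \<in> predicted_support a W X"
  shows "return borel z \<in> predicted_measures a W X"
proof -
  obtain x w where x: "x \<in> X" and w: "w \<in> W" and z: "z = a x + w"
    using z by (auto simp: predicted_support_def)
  \<comment> \<open>The noise value \<open>w\<close> that produces \<open>z\<close> is kept for
    every starting point \<open>y\<close>, so the support condition holds on all of \<open>X\<close>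
    and not only at \<open>x\<close>.\<close>
  define K where "K = (\<lambda>y. return borel (a y + w))"
  have K_meas: "K \<in> borel \<rightarrow>\<^sub>M prob_algebra borel"
    unfolding K_def by (rule measurable_compose[OF a measurable_return_prob_space])
  \<comment> \<open>A Dirac measure gives mass 1 to a measurable set containing its point;
    \<open>shift\<close> provides the measurability of the translates.\<close>
  have "K \<in> transition_kernels a W X"
    unfolding transition_kernels_def
    using K_meas w shift by (auto simp: K_def intro!: return_in_measures_supported_on)
  moreover have "return borel x \<bind> K = return borel z"
    using bind_return[OF measurable_prob_algebraD[OF K_meas], of x] by (simp add: K_def z)
  ultimately show ?thesis
    using return_in_measures_supported_on[OF X x] unfolding predicted_measures_def by force
qed

text \<open>Coordinates are polynomials, hence continuous. This is the source of the Borel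
  measurability of the system map.\<close>

lemma polynomial_map_continuous_on:
  fixes f :: "real^'n \<Rightarrow> real^'m"
  assumes "polynomial_map_of_degree_le d f"
  shows "continuous_on UNIV f"
proof -
  have "continuous_on UNIV (\<lambda>x. f x $ j)" for j
  proof -
    have "real_polynomial_function (\<lambda>x. f x $ j)"
      using assms polynomial_of_degree_le_imp_real_polynomial_function
      unfolding polynomial_map_of_degree_le_def by blast
    then show ?thesis
      by (intro continuous_on_polymonial_function) (simp add: real_polynomial_function_eq)
  qed
  then have "continuous_on UNIV (\<lambda>x. \<chi> j. f x $ j)" by (intro continuous_on_vec_lambda)
  then show ?thesis by simp
qed

lemma predicted_support_eq:
  fixes a :: "'a::ab_group_add \<Rightarrow> 'a"
  shows "predicted_support a W X = {z. \<exists>x\<in>X. z - a x \<in> W}"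
proof (intro set_eqI iffI)
  fix z assume "z \<in> {z. \<exists>x\<in>X. z - a x \<in> W}"
  then obtain x where "x \<in> X" "z - a x \<in> W" by blast
  moreover have "z = a x + (z - a x)" by simp
  ultimately show "z \<in> predicted_support a W X" unfolding predicted_support_def by blast
next
  fix z assume "z \<in> predicted_support a W X"
  then obtain x w where "x \<in> X" "w \<in> W" "z = a x + w"
    by (auto simp: predicted_support_def)
  then have "x \<in> X" "z - a x \<in> W" by simp_all
  then show "z \<in> {z. \<exists>x\<in>X. z - a x \<in> W}" by blast
qed

text \<open>Marginalisation: taking the whole space as the event for \<open>x\<close> in the
  defining identity of the conditional law leaves exactly the Chapman-Kolmogorov integral.\<close>

lemma distr_eq_bind_conditional_law:
  assumes x: "x \<in> borel_measurable M" and z: "z \<in> borel_measurable M"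
    and Q: "distr M borel x \<in> measures_supported_on X"
    and law: "conditional_law M x z K" and K: "K \<in> transition_kernels a W X"
  shows "distr M borel z = distr M borel x \<bind> K"
proof (rule measure_eqI)
  show "sets (distr M borel z) = sets (distr M borel x \<bind> K)"
    by (simp add: sets_Chapman_Kolmogorov[OF Q K])
  fix B assume "B \<in> sets (distr M borel z)"
  then have B: "B \<in> sets borel" by simp
  have "emeasure (distr M borel z) B = emeasure M {\<omega> \<in> space M. x \<omega> \<in> UNIV \<and> z \<omega> \<in> B}"
    using z B by (simp add: emeasure_distr vimage_def Int_def conj_commute)
  also have "\<dots> = (\<integral>\<^sup>+y\<in>UNIV. emeasure (K y) B \<partial>distr M borel x)"
    using law B sets.top[of borel] unfolding conditional_law_def by force
  also have "\<dots> = emeasure (distr M borel x \<bind> K) B"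
    by (simp add: emeasure_Chapman_Kolmogorov[OF Q K B])
  finally show "emeasure (distr M borel z) B = emeasure (distr M borel x \<bind> K) B" .
qed

theorem theorem1:
  fixes a :: "nat \<Rightarrow> real^'n \<Rightarrow> real^'n"
    and W X :: "nat \<Rightarrow> (real^'n) set"
    and d k :: nat
  assumes "k \<ge> 1"
    and "polynomial_map_of_degree_le d (a (k - 1))"
    and "compact (W (k - 1))"
    and "basic_semialgebraic (W (k - 1))"
    and "X (k - 1) \<in> sets borel"
  shows
    "(\<forall>(M :: 'm measure) x w K.
        prob_space M \<longrightarrow>
        x (k - 1) \<in> borel_measurable M \<longrightarrow> w (k - 1) \<in> borel_measurable M \<longrightarrow>
        x k \<in> borel_measurable M \<longrightarrow>
        (\<forall>\<omega>\<in>space M. x k \<omega> = a (k - 1) (x (k - 1) \<omega>) + w (k - 1) \<omega>) \<longrightarrow>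
        distr M borel (x (k - 1)) \<in> measures_supported_on (X (k - 1)) \<longrightarrow>
        conditional_law M (x (k - 1)) (x k) K \<longrightarrow>
        K \<in> transition_kernels (a (k - 1)) (W (k - 1)) (X (k - 1)) \<longrightarrow>
        distr M borel (x k) \<in> predicted_measures (a (k - 1)) (W (k - 1)) (X (k - 1)))
     \<and> inference_equiv
         (predicted_measures (a (k - 1)) (W (k - 1)) (X (k - 1)))
         (measure_convex_hull
            {return borel xh | xh. xh \<in> predicted_support (a (k - 1)) (W (k - 1)) (X (k - 1))})
     \<and> predicted_support (a (k - 1)) (W (k - 1)) (X (k - 1)) =
         {z. \<exists>x\<in>X (k - 1). z - a (k - 1) x \<in> W (k - 1)}"
proof (intro conjI allI impI)
  fix M :: "'m measure" and x w :: "nat \<Rightarrow> 'm \<Rightarrow> real^'n" and K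
  assume "x (k - 1) \<in> borel_measurable M" "x k \<in> borel_measurable M"
    and Q: "distr M borel (x (k - 1)) \<in> measures_supported_on (X (k - 1))"
    and "conditional_law M (x (k - 1)) (x k) K"
    and K: "K \<in> transition_kernels (a (k - 1)) (W (k - 1)) (X (k - 1))"
  \<comment> \<open>The prior law and the given conditional law serve directly as the
    \<open>Q\<close> and \<open>K\<close> of a predicted measure.\<close>
  then have "distr M borel (x k) = distr M borel (x (k - 1)) \<bind> K"
    by (intro distr_eq_bind_conditional_law)
  with Q K show "distr M borel (x k) \<in> predicted_measures (a (k - 1)) (W (k - 1)) (X (k - 1))"
    by (auto simp: predicted_measures_def)
next
  let ?S = "predicted_support (a (k - 1)) (W (k - 1)) (X (k - 1))"
  let ?A = "predicted_measures (a (k - 1)) (W (k - 1)) (X (k - 1))"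
  let ?B = "measure_convex_hull {return borel xh | xh. xh \<in> ?S}"
  have a: "a (k - 1) \<in> borel_measurable borel"
    by (intro borel_measurable_continuous_onI polynomial_map_continuous_on[OF assms(2)])
  \<comment> \<open>Compactness of the noise set enters here: its translates are compact, hence
    closed and Borel.\<close>
  have "{a (k - 1) y + w | w. w \<in> W (k - 1)} \<in> sets borel" for y
    using compact_translation[OF assms(3), of "a (k - 1) y"]
    by (simp add: Setcompr_eq_image borel_compact)
  then have dirac: "return borel z \<in> ?A" if "z \<in> ?S" for z
    using that a assms(5) by (intro return_in_predicted_measures borel_measurable_add) auto
  show "inference_equiv ?A ?B"
    unfolding inference_equiv_def
  proof (intro allI impI)
    fix g :: "real^'n \<Rightarrow> real"
    assume g: "g \<in> borel_measurable borel" "bounded (range g)"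
    \<comment> \<open>Both upper expectations are compared with the supremum of \<open>g\<close>
      over the predicted support, by the same lemma.\<close>
    have "(SUP P\<in>?A. ereal (\<integral>x. g x \<partial>P)) = (SUP z\<in>?S. ereal (g z))"
      by (intro SUP_expectation_eq_SUP dirac sets_predicted_measures
          emeasure_predicted_measures[OF _ assms(5)] g)
    also have "\<dots> = (SUP P\<in>?B. ereal (\<integral>x. g x \<partial>P))"
      by (intro SUP_expectation_eq_SUP[symmetric] return_in_measure_convex_hull
          sets_measure_convex_hull emeasure_measure_convex_hull g)
    finally show "(SUP P\<in>?A. ereal (\<integral>x. g x \<partial>P)) = (SUP P\<in>?B. ereal (\<integral>x. g x \<partial>P))" .
  qed
next
  show "predicted_support (a (k - 1)) (W (k - 1)) (X (k - 1)) =
         {z. \<exists>x\<in>X (k - 1). z - a (k - 1) x \<in> W (k - 1)}"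
    by (simp only: predicted_support_eq)
qed

end
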